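(* Let $\mathcal{M},\mathcal{N}$ be structures with $M\subseteq N^n$ and suppose that the inclusion $M\hookrightarrow N^n$ is a trace definition of $\mathcal{M}$ in $\mathcal{N}$. Suppose that $X$ is an $\mathcal{M}$-definable subset of $M^m$ and $Y$ is an $\mathcal{N}$-definable subset of $N^{mn}$ such that $X=Y\cap M^m$. Then $\mathrm{RM}_{\mathcal{M}}(X)\le\mathrm{RM}_{\mathcal{N}}(Y)$.
   Context: "Definable" means first order definable with parameters. A map $\tau\colon M\to N^n$ is a trace definition of $\mathcal{M}$ in $\mathcal{N}$ if for every $m\ge 1$ and every $\mathcal{M}$-definable $X\subseteq M^m$ there is an $\mathcal{N}$-definable $Y\subseteq N^{mn}$ with $X=\{(a_1,\dots,a_m)\in M^m : (\tau(a_1),\dots,\tau(a_m))\in Y\}$. $\mathrm{RM}_{\mathcal{M}}(X)$ is the Morley rank of the definable set $X$ in $\mathcal{M}$ (computed, as usual, in a sufficiently saturated elementary extension; $\infty$ if not an ordinal). *)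

theory Defs
  imports Main
begin

record ('f, 'r) lang =
  fun_syms :: "('f \<times> nat) set"
  rel_syms :: "('r \<times> nat) set"

record ('f, 'r, 'a) struct =
  univ :: "'a set"
  funs :: "'f \<Rightarrow> 'a list \<Rightarrow> 'a"
  rels :: "'r \<Rightarrow> 'a list \<Rightarrow> bool"

definition tuples :: "'a set \<Rightarrow> nat \<Rightarrow> 'a list set" where
  "tuples A m = {xs. length xs = m \<and> set xs \<subseteq> A}"

definition is_structure :: "('f, 'r) lang \<Rightarrow> ('f, 'r, 'a) struct \<Rightarrow> bool" where
  "is_structure L M \<longleftrightarrow> univ M \<noteq> {} \<and>
     (\<forall>(f, k) \<in> fun_syms L. \<forall>as \<in> tuples (univ M) k. funs M f as \<in> univ M)"

datatype 'f tm = Var nat | Fn 'f "'f tm list"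

datatype ('f, 'r) fm =
    Eq "'f tm" "'f tm"
  | Rel 'r "'f tm list"
  | Neg "('f, 'r) fm"
  | Conj "('f, 'r) fm" "('f, 'r) fm"
  | Ex nat "('f, 'r) fm"

fun wf_tm :: "('f, 'r) lang \<Rightarrow> 'f tm \<Rightarrow> bool" where
  "wf_tm L (Var i) \<longleftrightarrow> True"
| "wf_tm L (Fn f ts) \<longleftrightarrow> (f, length ts) \<in> fun_syms L \<and> (\<forall>t \<in> set ts. wf_tm L t)"

primrec wf_fm :: "('f, 'r) lang \<Rightarrow> ('f, 'r) fm \<Rightarrow> bool" where
  "wf_fm L (Eq s t) \<longleftrightarrow> wf_tm L s \<and> wf_tm L t"
| "wf_fm L (Rel r ts) \<longleftrightarrow> (r, length ts) \<in> rel_syms L \<and> (\<forall>t \<in> set ts. wf_tm L t)"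
| "wf_fm L (Neg p) \<longleftrightarrow> wf_fm L p"
| "wf_fm L (Conj p q) \<longleftrightarrow> wf_fm L p \<and> wf_fm L q"
| "wf_fm L (Ex i p) \<longleftrightarrow> wf_fm L p"

primrec eval_tm :: "('f, 'r, 'a) struct \<Rightarrow> (nat \<Rightarrow> 'a) \<Rightarrow> 'f tm \<Rightarrow> 'a" where
  "eval_tm M e (Var i) = e i"
| "eval_tm M e (Fn f ts) = funs M f (map (eval_tm M e) ts)"

primrec sat :: "('f, 'r, 'a) struct \<Rightarrow> (nat \<Rightarrow> 'a) \<Rightarrow> ('f, 'r) fm \<Rightarrow> bool" where
  "sat M e (Eq s t) \<longleftrightarrow> eval_tm M e s = eval_tm M e t"
| "sat M e (Rel r ts) \<longleftrightarrow> rels M r (map (eval_tm M e) ts)"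
| "sat M e (Neg p) \<longleftrightarrow> \<not> sat M e p"
| "sat M e (Conj p q) \<longleftrightarrow> sat M e p \<and> sat M e q"
| "sat M e (Ex i p) \<longleftrightarrow> (\<exists>a \<in> univ M. sat M (e(i := a)) p)"

text \<open>
  A formula with parameters in variables \<open>x\<^sub>0, \<dots>, x\<^sub>m\<^sub>-\<^sub>1\<close> is encoded as a pair of a
  formula \<open>\<phi>\<close> and a sequence \<open>e\<close>: the variables with index below \<open>m\<close> stand for the
  coordinates, and the variable with index \<open>m + i\<close> is a name for the parameter \<open>e i\<close>.
  Only the finitely many parameters whose variable occurs in \<open>\<phi>\<close> matter.
\<close>

definition assign :: "'a list \<Rightarrow> (nat \<Rightarrow> 'a) \<Rightarrow> nat \<Rightarrow> 'a" where
  "assign as e i = (if i < length as then as ! i else e (i - length as))"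

definition formulas_over :: "('f, 'r) lang \<Rightarrow> 'a set \<Rightarrow> (('f, 'r) fm \<times> (nat \<Rightarrow> 'a)) set" where
  "formulas_over L A = {(\<phi>, e). wf_fm L \<phi> \<and> range e \<subseteq> A}"

definition defset :: "('f, 'r, 'a) struct \<Rightarrow> nat \<Rightarrow> ('f, 'r) fm \<Rightarrow> (nat \<Rightarrow> 'a) \<Rightarrow> 'a list set" where
  "defset M m \<phi> e = {as \<in> tuples (univ M) m. sat M (assign as e) \<phi>}"

definition definable :: "('f, 'r) lang \<Rightarrow> ('f, 'r, 'a) struct \<Rightarrow> nat \<Rightarrow> 'a list set \<Rightarrow> bool" where
  "definable L M m X \<longleftrightarrow> (\<exists>(\<phi>, e) \<in> formulas_over L (univ M). X = defset M m \<phi> e)"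

text \<open>
  The power \<open>(N\<^sup>n)\<^sup>m\<close> is identified with \<open>N\<^sup>m\<^sup>n\<close> by concatenation of tuples.
\<close>

definition trace_definition ::
  "('f, 'r) lang \<Rightarrow> ('f, 'r, 'a) struct \<Rightarrow> ('g, 's) lang \<Rightarrow> ('g, 's, 'b) struct \<Rightarrow> nat \<Rightarrow>
   ('a \<Rightarrow> 'b list) \<Rightarrow> bool" where
  "trace_definition L M K N n \<tau> \<longleftrightarrow>
     (\<forall>a \<in> univ M. \<tau> a \<in> tuples (univ N) n) \<and>
     (\<forall>m\<ge>1. \<forall>X. definable L M m X \<longrightarrow>
        (\<exists>Y. definable K N (m * n) Y \<and> X = {as \<in> tuples (univ M) m. concat (map \<tau> as) \<in> Y}))"

definition elementary_embedding ::
  "('f, 'r) lang \<Rightarrow> ('f, 'r, 'a) struct \<Rightarrow> ('a \<Rightarrow> 'b) \<Rightarrow> ('f, 'r, 'b) struct \<Rightarrow> bool" where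
  "elementary_embedding L M j M' \<longleftrightarrow>
     j ` univ M \<subseteq> univ M' \<and>
     (\<forall>(\<phi>, e) \<in> formulas_over L (univ M). sat M e \<phi> \<longleftrightarrow> sat M' (j \<circ> e) \<phi>)"

text \<open>
  \<open>\<aleph>\<^sub>0\<close>-saturation: every partial 1-type over a finite parameter set is realised.  Since
  structures are nonempty, nothing is lost for the empty parameter set, over which there
  are no parameter sequences: a type over it is also a type over any singleton.
\<close>

definition aleph0_saturated :: "('f, 'r) lang \<Rightarrow> ('f, 'r, 'a) struct \<Rightarrow> bool" where
  "aleph0_saturated L M \<longleftrightarrow>
     (\<forall>A p. finite A \<and> A \<subseteq> univ M \<and> p \<subseteq> formulas_over L A \<and>
        (\<forall>q. finite q \<and> q \<subseteq> p \<longrightarrow> (\<exists>a \<in> univ M. \<forall>(\<phi>, e) \<in> q. sat M (assign [a] e) \<phi>)) \<longrightarrow>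
        (\<exists>a \<in> univ M. \<forall>(\<phi>, e) \<in> p. sat M (assign [a] e) \<phi>))"

text \<open>
  An elementary extension is given as an elementary embedding, so that the extension may
  live in a larger type.
\<close>

definition saturated_extension ::
  "('f, 'r) lang \<Rightarrow> ('f, 'r, 'a) struct \<Rightarrow> ('a \<Rightarrow> 'b) \<Rightarrow> ('f, 'r, 'b) struct \<Rightarrow> bool" where
  "saturated_extension L M j M' \<longleftrightarrow>
     is_structure L M' \<and> elementary_embedding L M j M' \<and> aleph0_saturated L M'"

text \<open>
  Ordinals are represented by the elements of an arbitrary type of class \<open>wellorder\<close>;
  an element stands for the order type of its strict lower segment.
\<close>

definition zero_ord :: "'o::wellorder \<Rightarrow> bool" where
  "zero_ord \<alpha> \<longleftrightarrow> (\<forall>\<beta>. \<alpha> \<le> \<beta>)"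

definition succ_ord :: "'o::wellorder \<Rightarrow> 'o \<Rightarrow> bool" where
  "succ_ord \<beta> \<alpha> \<longleftrightarrow> \<beta> < \<alpha> \<and> (\<forall>\<gamma><\<alpha>. \<gamma> \<le> \<beta>)"

definition limit_ord :: "'o::wellorder \<Rightarrow> bool" where
  "limit_ord \<alpha> \<longleftrightarrow> \<not> zero_ord \<alpha> \<and> \<not> (\<exists>\<beta>. succ_ord \<beta> \<alpha>)"

text \<open>
  The relation \<open>RM(A) \<ge> \<alpha>\<close>, evaluated inside the given structure, which therefore has to
  be \<open>\<aleph>\<^sub>0\<close>-saturated for this to be Morley rank.  Each clause for \<open>\<alpha>\<close> refers to smaller
  ordinals only, so the inductive definition is the usual transfinite recursion.
\<close>

inductive rank_ge ::
  "('f, 'r) lang \<Rightarrow> ('f, 'r, 'a) struct \<Rightarrow> nat \<Rightarrow> 'a list set \<Rightarrow> 'o::wellorder \<Rightarrow> bool"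
  for L M m where
  zero: "zero_ord \<alpha> \<Longrightarrow> A \<noteq> {} \<Longrightarrow> rank_ge L M m A \<alpha>"
| succ: "succ_ord \<beta> \<alpha> \<Longrightarrow>
    (\<And>i::nat. definable L M m (B i)) \<Longrightarrow> (\<And>i. B i \<subseteq> A) \<Longrightarrow>
    (\<And>i j. i \<noteq> j \<Longrightarrow> B i \<inter> B j = {}) \<Longrightarrow> (\<And>i. rank_ge L M m (B i) \<beta>) \<Longrightarrow>
    rank_ge L M m A \<alpha>"
| limit: "limit_ord \<alpha> \<Longrightarrow> (\<And>\<beta>. \<beta> < \<alpha> \<Longrightarrow> rank_ge L M m A \<beta>) \<Longrightarrow> rank_ge L M m A \<alpha>"

text \<open>
  \<open>RM\<^sub>M(X) \<ge> \<alpha>\<close>, computed in the \<open>\<aleph>\<^sub>0\<close>-saturated elementary extension \<open>j : M \<rightarrow> M'\<close>: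
  a formula with parameters defining \<open>X\<close> in \<open>M\<close> is interpreted in \<open>M'\<close>.  By elementarity
  the resulting set does not depend on the formula.  The rank of \<open>X\<close> is at least \<open>0\<close>
  iff \<open>X\<close> is nonempty (otherwise it is \<open>-\<infinity>\<close>), and it is \<open>\<infinity>\<close> iff it is at least every ordinal.
\<close>

definition morley_rank_ge ::
  "('f, 'r) lang \<Rightarrow> ('f, 'r, 'a) struct \<Rightarrow> ('a \<Rightarrow> 'b) \<Rightarrow> ('f, 'r, 'b) struct \<Rightarrow>
   nat \<Rightarrow> 'a list set \<Rightarrow> 'o::wellorder \<Rightarrow> bool" where
  "morley_rank_ge L M j M' m X \<alpha> \<longleftrightarrow>
     (\<exists>(\<phi>, e) \<in> formulas_over L (univ M).
        X = defset M m \<phi> e \<and> rank_ge L M' m (defset M' m \<phi> (j \<circ> e)) \<alpha>)"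

end

theory Submission
  imports Defs "HOL.Filter" "HOL-Library.Nat_Bijection"
begin

text \<open>
  Induction on the rank, for \<open>\<phi>(M', b)\<close> and \<open>\<psi>(N', d)\<close> where some filter \<open>U\<close> on pairs \<open>(e, f)\<close>
  of parameter sequences of \<open>M\<close> and \<open>N\<close> converges to the types of \<open>b\<close> and \<open>d\<close> and contains the
  set of \<open>(e, f)\<close> with \<open>\<phi>(M, e) \<subseteq> \<psi>(N, f)\<close>.  Given disjoint \<open>\<phi>\<^sub>i(M', b\<^sub>i) \<subseteq> \<phi>(M', b)\<close>, the
  trace definition, applied to the \<open>\<emptyset>\<close>-definable sets of the \<open>\<phi>\<^sub>i\<close> with their parameters turned into
  coordinates, gives \<open>\<psi>\<^sub>i\<close> and functions \<open>g\<^sub>i\<close> with \<open>\<phi>\<^sub>i(M, e) = \<psi>\<^sub>i(N, g\<^sub>i(e)) \<inter> M\<^sup>m\<close> for all \<open>e\<close>.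
  An ultrafilter refining \<open>U\<close> determines the type that the parameters \<open>d\<^sub>i\<close> of \<open>\<psi>\<^sub>i\<close> should have
  over finitely many entries of \<open>d\<close>, and saturation of \<open>N'\<close> realises it.  The sets
  \<open>\<psi>\<^sub>i \<and> \<psi> \<and> \<And>\<^sub>j\<^sub><\<^sub>i \<not> \<psi>\<^sub>j\<close> then witness the rank of \<open>\<psi>(N', d)\<close>.
\<close>

subsection \<open>Free variables and renaming\<close>

primrec vars_tm :: "'f tm \<Rightarrow> nat set" where
  "vars_tm (Var i) = {i}"
| "vars_tm (Fn f ts) = \<Union> (set (map vars_tm ts))"

primrec fv :: "('f, 'r) fm \<Rightarrow> nat set" where
  "fv (Eq s t) = vars_tm s \<union> vars_tm t"
| "fv (Rel r ts) = \<Union> (vars_tm ` set ts)"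
| "fv (Neg p) = fv p"
| "fv (Conj p q) = fv p \<union> fv q"
| "fv (Ex i p) = fv p - {i}"

primrec ren_tm :: "(nat \<Rightarrow> nat) \<Rightarrow> 'f tm \<Rightarrow> 'f tm" where
  "ren_tm \<rho> (Var i) = Var (\<rho> i)"
| "ren_tm \<rho> (Fn f ts) = Fn f (map (ren_tm \<rho>) ts)"

text \<open>Bound variables are renamed along with the free ones, so an injective \<rho> causes no
  capture.\<close>

primrec ren :: "(nat \<Rightarrow> nat) \<Rightarrow> ('f, 'r) fm \<Rightarrow> ('f, 'r) fm" where
  "ren \<rho> (Eq s t) = Eq (ren_tm \<rho> s) (ren_tm \<rho> t)"
| "ren \<rho> (Rel r ts) = Rel r (map (ren_tm \<rho>) ts)"
| "ren \<rho> (Neg p) = Neg (ren \<rho> p)"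
| "ren \<rho> (Conj p q) = Conj (ren \<rho> p) (ren \<rho> q)"
| "ren \<rho> (Ex i p) = Ex (\<rho> i) (ren \<rho> p)"

lemma finite_vars_tm: "finite (vars_tm t)"
  by (induction t) auto

lemma finite_fv: "finite (fv \<phi>)"
  by (induction \<phi>) (auto simp: finite_vars_tm)

lemma eval_tm_cong: "(\<And>k. k \<in> vars_tm t \<Longrightarrow> e k = e' k) \<Longrightarrow> eval_tm M e t = eval_tm M e' t"
proof (induction t)
  case (Fn f ts)
  then have "map (eval_tm M e) ts = map (eval_tm M e') ts"
    by (auto intro!: map_cong)
  then show ?case
    by (simp only: eval_tm.simps)
qed simp

lemma sat_cong: "(\<And>k. k \<in> fv \<phi> \<Longrightarrow> e k = e' k) \<Longrightarrow> sat M e \<phi> = sat M e' \<phi>"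
proof (induction \<phi> arbitrary: e e')
  case (Eq s t)
  then have "eval_tm M e s = eval_tm M e' s" "eval_tm M e t = eval_tm M e' t"
    by (auto intro!: eval_tm_cong)
  then show ?case
    by simp
next
  case (Rel r ts)
  then have "map (eval_tm M e) ts = map (eval_tm M e') ts"
    by (auto intro!: map_cong eval_tm_cong)
  then show ?case
    by (simp only: sat.simps)
next
  case (Neg p)
  have "sat M e p = sat M e' p"
    by (rule Neg.IH) (use Neg.prems in auto)
  then show ?case
    by simp
next
  case (Conj p q)
  have "sat M e p = sat M e' p"
    by (rule Conj.IH(1)) (use Conj.prems in auto)
  moreover have "sat M e q = sat M e' q"
    by (rule Conj.IH(2)) (use Conj.prems in auto)
  ultimately show ?case
    by simp
next
  case (Ex i p)
  have "sat M (e(i := a)) p = sat M (e'(i := a)) p" for a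
    by (rule Ex.IH) (use Ex.prems in auto)
  then show ?case
    by simp
qed

lemma sat_agree:
  assumes "fv \<phi> \<subseteq> {..<B}" "\<And>k. k < B \<Longrightarrow> e k = e' k"
  shows "sat M e \<phi> = sat M e' \<phi>"
  by (rule sat_cong) (use assms in auto)

lemma wf_ren_tm: "wf_tm L (ren_tm \<rho> t) = wf_tm L t"
  by (induction t) auto

lemma wf_ren [simp]: "wf_fm L (ren \<rho> \<phi>) = wf_fm L \<phi>"
  by (induction \<phi>) (auto simp: wf_ren_tm)

lemma eval_ren_tm: "eval_tm M e (ren_tm \<rho> t) = eval_tm M (\<lambda>i. e (\<rho> i)) t"
proof (induction t)
  case (Fn f ts)
  then have "map (eval_tm M e) (map (ren_tm \<rho>) ts) = map (eval_tm M (\<lambda>i. e (\<rho> i))) ts"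
    by simp
  then show ?case
    by (simp only: eval_tm.simps ren_tm.simps)
qed simp

text \<open>Injectivity serves the quantifier case: updating \<open>e\<close> at
  \<open>\<rho> i\<close> then changes \<open>e \<circ> \<rho>\<close> at \<open>i\<close> and
  nowhere else.\<close>

lemma sat_ren: "inj \<rho> \<Longrightarrow> sat M e (ren \<rho> \<phi>) = sat M (e \<circ> \<rho>) \<phi>"
proof (induction \<phi> arbitrary: e)
  case (Rel r ts)
  have "map (eval_tm M e) (map (ren_tm \<rho>) ts) = map (eval_tm M (e \<circ> \<rho>)) ts"
    by (simp add: eval_ren_tm comp_def)
  then show ?case
    by (simp only: sat.simps ren.simps)
next
  case (Ex i p)
  have "e(\<rho> i := a) \<circ> \<rho> = (e \<circ> \<rho>)(i := a)" for a
    using Ex.prems by (auto simp: fun_eq_iff inj_eq)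
  then have "sat M (e(\<rho> i := a)) (ren \<rho> p) = sat M ((e \<circ> \<rho>)(i := a)) p" for a
    by (simp only: Ex.IH[OF Ex.prems])
  then show ?case
    by (simp only: sat.simps ren.simps)
qed (auto simp: eval_ren_tm comp_def)

section \<open>Reindexing of parameters with fixed coordinates\<close>

definition shift :: "nat \<Rightarrow> (nat \<Rightarrow> nat) \<Rightarrow> nat \<Rightarrow> nat" where
  "shift m \<rho> x = (if x < m then x else m + \<rho> (x - m))"

lemma inj_shift: "inj \<rho> \<Longrightarrow> inj (shift m \<rho>)"
  by (rule injI) (auto simp: shift_def inj_eq split: if_splits)

lemma sat_ren_shift:
  assumes "inj \<rho>" "length as = m"
  shows "sat M (assign as e) (ren (shift m \<rho>) \<phi>) = sat M (assign as (e \<circ> \<rho>)) \<phi>"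
proof -
  have "assign as e \<circ> shift m \<rho> = assign as (e \<circ> \<rho>)"
    using assms by (auto simp: fun_eq_iff assign_def shift_def)
  then show ?thesis
    using assms by (simp add: sat_ren inj_shift)
qed

lemma assign_append: "assign (xs @ ys) e = assign xs (assign ys e)"
  by (auto simp: fun_eq_iff assign_def nth_append)

lemma range_assign: "set as \<subseteq> A \<Longrightarrow> range e \<subseteq> A \<Longrightarrow> range (assign as e) \<subseteq> A"
  by (auto simp: assign_def)

subsection \<open>Existential quantification over blocks of variables\<close>

lemma sat_foldr_Ex:
  "sat M e (foldr Ex vs \<phi>) \<longleftrightarrow>
     (\<exists>e'. (\<forall>k. k \<notin> set vs \<longrightarrow> e' k = e k) \<and> (\<forall>k \<in> set vs. e' k \<in> univ M) \<and> sat M e' \<phi>)"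
proof (induction vs arbitrary: e)
  case Nil
  have "e' = e" if "\<forall>k. e' k = e k" for e'
    using that by auto
  then show ?case
    by auto
next
  case (Cons v vs)
  show ?case
  proof
    assume "sat M e (foldr Ex (v # vs) \<phi>)"
    then obtain a where "a \<in> univ M" "sat M (e(v := a)) (foldr Ex vs \<phi>)"
      by auto
    then obtain e' where e': "\<forall>k. k \<notin> set vs \<longrightarrow> e' k = (e(v := a)) k"
        "\<forall>k \<in> set vs. e' k \<in> univ M" "sat M e' \<phi>"
      using Cons.IH by blast
    \<comment> \<open>The variable \<open>v\<close> may recur in \<open>vs\<close>; then
      \<open>e' v\<close> is a later witness instead of \<open>a\<close>.\<close>
    have "e' v \<in> univ M"
      using e' \<open>a \<in> univ M\<close> by (cases "v \<in> set vs") auto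
    with e' show "\<exists>e'. (\<forall>k. k \<notin> set (v # vs) \<longrightarrow> e' k = e k) \<and>
        (\<forall>k \<in> set (v # vs). e' k \<in> univ M) \<and> sat M e' \<phi>"
      by (intro exI[of _ e']) auto
  next
    assume "\<exists>e'. (\<forall>k. k \<notin> set (v # vs) \<longrightarrow> e' k = e k) \<and>
        (\<forall>k \<in> set (v # vs). e' k \<in> univ M) \<and> sat M e' \<phi>"
    then obtain e' where e': "\<forall>k. k \<notin> set (v # vs) \<longrightarrow> e' k = e k"
        "\<forall>k \<in> set (v # vs). e' k \<in> univ M" "sat M e' \<phi>"
      by blast
    have "sat M (e(v := e' v)) (foldr Ex vs \<phi>)"
      unfolding Cons.IH by (rule exI[of _ e']) (use e' in auto)
    then show "sat M e (foldr Ex (v # vs) \<phi>)"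
      using e' by auto
  qed
qed

lemma wf_foldr_Ex [simp]: "wf_fm L (foldr Ex vs \<phi>) = wf_fm L \<phi>"
  by (induction vs) auto

lemma fv_foldr_Ex: "fv (foldr Ex vs \<phi>) = fv \<phi> - set vs"
  by (induction vs) auto

text \<open>Some bound on the free variables, not necessarily the least; no variable from there on
  occurs free.\<close>

definition var_bound :: "('f, 'r) fm \<Rightarrow> nat" where
  "var_bound \<phi> = (SOME B. fv \<phi> \<subseteq> {..<B})"

lemma fv_var_bound: "fv \<phi> \<subseteq> {..<var_bound \<phi>}"
proof -
  have "\<exists>B. fv \<phi> \<subseteq> {..<B}"
    using finite_fv[of \<phi>] unfolding finite_nat_set_iff_bounded by blast
  then show ?thesis
    unfolding var_bound_def by (rule someI_ex)
qed

text \<open>The coordinates are moved to fresh variables, so that the parameters can take the indices from 0.\<close>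

definition ex_coords :: "nat \<Rightarrow> ('f, 'r) fm \<Rightarrow> ('f, 'r) fm" where
  "ex_coords m \<phi> = (let B = var_bound \<phi> in foldr Ex [B..<B + m]
     (ren (\<lambda>x. if x < m then B + x else if x < m + B then x - m else x) \<phi>))"

lemma wf_ex_coords [simp]: "wf_fm L (ex_coords m \<phi>) = wf_fm L \<phi>"
  by (simp add: ex_coords_def Let_def)

text \<open>Nonemptiness of a definable set becomes a first order condition on its parameters alone,
  so it depends only on their type.\<close>

lemma sat_ex_coords:
  "sat M e (ex_coords m \<phi>) \<longleftrightarrow> (\<exists>as \<in> tuples (univ M) m. sat M (assign as e) \<phi>)"
proof -
  define B where "B = var_bound \<phi>"
  have B: "fv \<phi> \<subseteq> {..<B}"
    unfolding B_def by (rule fv_var_bound)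
  define \<rho> where "\<rho> = (\<lambda>x. if x < m then B + x else if x < m + B then x - m else x)"
  define \<theta> where "\<theta> = foldr Ex [B..<B + m] (ren \<rho> \<phi>)"
  have \<theta>: "ex_coords m \<phi> = \<theta>"
    by (simp add: ex_coords_def \<theta>_def \<rho>_def Let_def flip: B_def)
  \<comment> \<open>The map exchanges two adjacent blocks of lengths \<open>m\<close> and
    \<open>B\<close> and fixes the rest, so it is a permutation.\<close>
  have inj: "inj \<rho>"
    by (rule injI) (auto simp: \<rho>_def split: if_splits)
  show ?thesis
    unfolding \<theta>
  proof
    assume "sat M e \<theta>"
    then obtain e' where e': "\<forall>k. k \<notin> set [B..<B + m] \<longrightarrow> e' k = e k"
        "\<forall>k \<in> set [B..<B + m]. e' k \<in> univ M" "sat M e' (ren \<rho> \<phi>)"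
      unfolding \<theta>_def sat_foldr_Ex by blast
    have "sat M (assign (map e' [B..<B + m]) e) \<phi> = sat M (e' \<circ> \<rho>) \<phi>"
      by (rule sat_agree[OF B]) (use e'(1) in \<open>auto simp: assign_def \<rho>_def\<close>)
    then have "sat M (assign (map e' [B..<B + m]) e) \<phi>"
      using e' inj by (simp add: sat_ren)
    moreover have "map e' [B..<B + m] \<in> tuples (univ M) m"
      using e' by (auto simp: tuples_def)
    ultimately show "\<exists>as \<in> tuples (univ M) m. sat M (assign as e) \<phi>"
      by blast
  next
    assume "\<exists>as \<in> tuples (univ M) m. sat M (assign as e) \<phi>"
    then obtain as where as: "length as = m" "set as \<subseteq> univ M" "sat M (assign as e) \<phi>"
      by (auto simp: tuples_def)
    define e' where "e' k = (if B \<le> k \<and> k < B + m then as ! (k - B) else e k)" for k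
    have "sat M (assign as e) \<phi> = sat M (e' \<circ> \<rho>) \<phi>"
      by (rule sat_agree[OF B]) (use as in \<open>auto simp: assign_def \<rho>_def e'_def\<close>)
    then have "sat M e' (ren \<rho> \<phi>)"
      using as inj by (simp add: sat_ren)
    then show "sat M e \<theta>"
      unfolding \<theta>_def sat_foldr_Ex
      by (intro exI[of _ e']) (use as in \<open>auto simp: e'_def subset_iff\<close>)
  qed
qed

subsection \<open>Ultrafilters and realised types\<close>

definition ultra :: "'i filter \<Rightarrow> bool" where
  "ultra U \<longleftrightarrow> U \<noteq> bot \<and> (\<forall>P. eventually P U \<or> eventually (\<lambda>x. \<not> P x) U)"

text \<open>Zorn's lemma for the proper filters below \<open>F\<close>, where smaller means finer:
  whatever is eventual for the infimum of a nonempty chain is eventual for some member, so the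
  infimum is proper. A minimal filter decides every predicate.\<close>

lemma ultrafilter_below:
  assumes "F \<noteq> bot"
  obtains U where "U \<le> F" "ultra U"
proof -
  define A where "A = {U. U \<le> F \<and> U \<noteq> bot}"
  have "\<exists>m \<in> A. \<forall>a \<in> A. m \<ge> a \<longrightarrow> a = m"
  proof (rule predicate_Zorn)
    show "partial_order_on A (relation_of (\<ge>) A)"
      by (rule partial_order_on_relation_ofI) auto
    fix C assume "C \<in> Chains (relation_of (\<ge>) A)"
    then have C: "C \<subseteq> A" "\<And>U V. U \<in> C \<Longrightarrow> V \<in> C \<Longrightarrow> U \<le> V \<or> V \<le> U"
      by (auto simp: Chains_def relation_of_def)
    show "\<exists>u \<in> A. \<forall>a \<in> C. a \<ge> u"
    proof (cases "C = {}")
      case True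
      then show ?thesis
        using assms by (auto simp: A_def)
    next
      case False
      have "eventually P (Inf C) \<longleftrightarrow> (\<exists>b\<in>C. eventually P b)" for P
        by (rule eventually_Inf_base[OF False]) (use C(2) in \<open>metis inf.absorb1 inf.absorb2\<close>)
      then have "Inf C \<noteq> bot"
        using C(1) by (auto simp: trivial_limit_def A_def)
      moreover have "Inf C \<le> F"
        using False C(1) by (auto simp: A_def intro: Inf_lower2)
      ultimately show ?thesis
        by (auto simp: A_def intro!: bexI[of _ "Inf C"] Inf_lower)
    qed
  qed
  then obtain U where U: "U \<in> A" and max: "\<And>V. V \<in> A \<Longrightarrow> V \<le> U \<Longrightarrow> V = U"
    by blast
  have "eventually P U \<or> eventually (\<lambda>x. \<not> P x) U" for P
  proof (rule disjCI)
    assume not: "\<not> eventually (\<lambda>x. \<not> P x) U"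
    \<comment> \<open>Since \<open>P\<close> is compatible with \<open>U\<close>, adjoining it
      leaves the filter proper, and minimality forces equality.\<close>
    let ?V = "inf U (principal {x. P x})"
    have "?V \<noteq> bot"
      using not by (simp add: trivial_limit_def eventually_inf_principal)
    then have "?V = U"
      using U by (intro max) (auto simp: A_def intro: le_infI1)
    moreover have "eventually P ?V"
      by (simp add: eventually_inf_principal)
    ultimately show "eventually P U"
      by simp
  qed
  then show thesis
    using U that by (auto simp: A_def ultra_def)
qed

text \<open>Convergence along \<open>V\<close>: the types of the \<open>x i\<close> in the variables
  from \<open>A\<close> tend to the type of \<open>d\<close>. For a proper filter the reverse
  implication comes from negated formulas.\<close>

definition approximates :: "('f, 'r) lang \<Rightarrow> ('f, 'r, 'a) struct \<Rightarrow> ('f, 'r, 'b) struct \<Rightarrow> nat set \<Rightarrow>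
    'i filter \<Rightarrow> ('i \<Rightarrow> nat \<Rightarrow> 'a) \<Rightarrow> (nat \<Rightarrow> 'b) \<Rightarrow> bool" where
  "approximates L M M' A V x d \<longleftrightarrow> range d \<subseteq> univ M' \<and>
     (\<forall>\<chi>. wf_fm L \<chi> \<and> fv \<chi> \<subseteq> A \<and> sat M' d \<chi> \<longrightarrow> (\<forall>\<^sub>F i in V. sat M (x i) \<chi>))"

lemma approximatesD:
  "approximates L M M' A V x d \<Longrightarrow> wf_fm L \<chi> \<Longrightarrow> fv \<chi> \<subseteq> A \<Longrightarrow> sat M' d \<chi> \<Longrightarrow> \<forall>\<^sub>F i in V. sat M (x i) \<chi>"
  by (simp add: approximates_def)

lemma approximatesD_converse:
  assumes "approximates L M M' A V x d" "V \<noteq> bot" "wf_fm L \<chi>" "fv \<chi> \<subseteq> A"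
    "\<forall>\<^sub>F i in V. sat M (x i) \<chi>"
  shows "sat M' d \<chi>"
proof (rule ccontr)
  assume "\<not> sat M' d \<chi>"
  then have "\<forall>\<^sub>F i in V. sat M (x i) (Neg \<chi>)"
    using assms by (intro approximatesD[OF assms(1)]) auto
  with assms(5) have "\<forall>\<^sub>F i in V. False"
    by eventually_elim simp
  then show False
    using assms(2) by (simp add: trivial_limit_def)
qed

text \<open>The embedding preserves the type of \<open>r\<close>, which is the limit because
  \<open>x\<close> is eventually constant. This supplies the links at the start of the
  induction.\<close>

lemma approximates_elementary:
  assumes "elementary_embedding L M j M'" "range r \<subseteq> univ M" "\<forall>\<^sub>F i in V. x i = r"
  shows "approximates L M M' UNIV V x (j \<circ> r)"
  unfolding approximates_def
proof (intro conjI allI impI)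
  show "range (j \<circ> r) \<subseteq> univ M'"
    using assms by (auto simp: elementary_embedding_def)
  fix \<chi> assume "wf_fm L \<chi> \<and> fv \<chi> \<subseteq> UNIV \<and> sat M' (j \<circ> r) \<chi>"
  then have "sat M r \<chi>"
    using assms(1,2) unfolding elementary_embedding_def formulas_over_def by blast
  with assms(3) show "\<forall>\<^sub>F i in V. sat M (x i) \<chi>"
    by (auto elim: eventually_mono)
qed

text \<open>The list ends in a closed tautology, so that the empty conjunction adds no free
  variable.\<close>

definition Conjs :: "('f, 'r) fm list \<Rightarrow> ('f, 'r) fm" where
  "Conjs ps = foldr Conj ps (Neg (Ex 0 (Neg (Eq (Var 0) (Var 0)))))"

lemma sat_Conjs [simp]: "sat M e (Conjs ps) \<longleftrightarrow> (\<forall>p \<in> set ps. sat M e p)"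
  by (induction ps) (auto simp: Conjs_def)

lemma wf_Conjs [simp]: "wf_fm L (Conjs ps) \<longleftrightarrow> (\<forall>p \<in> set ps. wf_fm L p)"
  by (induction ps) (auto simp: Conjs_def)

lemma fv_Conjs [simp]: "fv (Conjs ps) = \<Union> (fv ` set ps)"
  by (induction ps) (auto simp: Conjs_def)

text \<open>The formulas that hold eventually along \<open>V\<close> prescribe a type for entry
  \<open>k\<close> over the earlier entries of \<open>d\<close>. It is finitely satisfiable,
  saturation realises it, and it is complete because \<open>V\<close> is an ultrafilter.\<close>

lemma realise_step:
  assumes sat: "aleph0_saturated L M'"
    and V: "ultra V" and x: "\<forall>\<^sub>F i in V. range (x i) \<subseteq> univ M"
    and d: "approximates L M M' {..<k} V x d"
  obtains a where "approximates L M M' {..<Suc k} V x (d(k := a))"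
proof -
  have d_univ: "d i \<in> univ M'" for i
    using d by (auto simp: approximates_def)
  define T where "T = {\<chi>. wf_fm L \<chi> \<and> fv \<chi> \<subseteq> {..<Suc k} \<and> (\<forall>\<^sub>F i in V. sat M (x i) \<chi>)}"
  \<comment> \<open>Variable \<open>k\<close> becomes the variable 0 of the 1-type, and each
    \<open>i < k\<close> becomes \<open>Suc i\<close>, the name of parameter
    \<open>i\<close>.\<close>
  define \<rho> where "\<rho> i = (if i = k then 0 else if i < k then Suc i else i)" for i
  have inj: "inj \<rho>"
    by (rule injI) (auto simp: \<rho>_def split: if_splits)
  \<comment> \<open>Capping the index makes the parameter set finite; using \<open>k\<close> as the
    cap keeps this meaningful for \<open>k = 0\<close>.\<close>
  define e where "e i = d (min i k)" for i
  define p where "p = (\<lambda>\<chi>. (ren \<rho> \<chi>, e)) ` T"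
  have sat_p: "sat M' (assign [a] e) (ren \<rho> \<chi>) \<longleftrightarrow> sat M' (d(k := a)) \<chi>" if "fv \<chi> \<subseteq> {..<Suc k}" for \<chi> a
    unfolding sat_ren[OF inj] by (rule sat_agree[OF that]) (auto simp: \<rho>_def e_def assign_def)
  have "\<exists>a \<in> univ M'. \<forall>(\<phi>, e) \<in> p. sat M' (assign [a] e) \<phi>"
  proof (rule sat[unfolded aleph0_saturated_def, rule_format, of "d ` {..k}"], intro conjI allI impI)
    show "finite (d ` {..k})" "d ` {..k} \<subseteq> univ M'"
      using d_univ by auto
    show "p \<subseteq> formulas_over L (d ` {..k})"
      by (auto simp: p_def T_def formulas_over_def e_def)
    fix q assume "finite q \<and> q \<subseteq> p"
    then obtain Q where Q: "finite Q" "Q \<subseteq> T" "q = (\<lambda>\<chi>. (ren \<rho> \<chi>, e)) ` Q"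
      unfolding p_def by (meson finite_subset_image)
    obtain qs where qs: "set qs = Q"
      using Q finite_list by blast
    \<comment> \<open>Eventually \<open>x i k\<close> witnesses this formula, whose free variables
      lie below \<open>k\<close>, so it passes to \<open>d\<close>.\<close>
    have "sat M' d (Ex k (Conjs qs))"
    proof (rule approximatesD_converse[OF d])
      show "V \<noteq> bot"
        using V by (simp add: ultra_def)
      show "wf_fm L (Ex k (Conjs qs))" "fv (Ex k (Conjs qs)) \<subseteq> {..<k}"
        using Q qs by (fastforce simp: T_def)+
      have "\<forall>\<^sub>F i in V. \<forall>\<chi> \<in> Q. sat M (x i) \<chi>"
        using Q by (intro eventually_ball_finite) (auto simp: T_def)
      with x show "\<forall>\<^sub>F i in V. sat M (x i) (Ex k (Conjs qs))"
      proof eventually_elim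
        case (elim i)
        then show ?case
          using qs by (auto intro!: bexI[of _ "x i k"])
      qed
    qed
    then obtain a where "a \<in> univ M'" "\<forall>\<chi>\<in>Q. sat M' (d(k := a)) \<chi>"
      using qs by auto
    then show "\<exists>a \<in> univ M'. \<forall>(\<phi>, e) \<in> q. sat M' (assign [a] e) \<phi>"
      using Q sat_p by (auto simp: T_def intro!: bexI[of _ a])
  qed
  then obtain a where a: "a \<in> univ M'" "\<And>\<chi>. \<chi> \<in> T \<Longrightarrow> sat M' (d(k := a)) \<chi>"
    using sat_p by (auto simp: p_def T_def)
  show thesis
  proof (rule that[of a], unfold approximates_def, intro conjI allI impI)
    show "range (d(k := a)) \<subseteq> univ M'"
      using a d_univ by auto
    fix \<chi> assume \<chi>: "wf_fm L \<chi> \<and> fv \<chi> \<subseteq> {..<Suc k} \<and> sat M' (d(k := a)) \<chi>"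
    then have "Neg \<chi> \<notin> T"
      using a(2) by force
    with \<chi> have "\<not> (\<forall>\<^sub>F i in V. \<not> sat M (x i) \<chi>)"
      by (simp add: T_def)
    then show "\<forall>\<^sub>F i in V. sat M (x i) \<chi>"
      using V by (auto simp: ultra_def)
  qed
qed

text \<open>Entries \<open>k\<close>, \<open>k + 1\<close>, ... are chosen one at a time, each over
  finitely many parameters. Later stages leave earlier entries alone, and a formula sees only
  finitely many entries, so the limit sequence has the right type.\<close>

lemma realise:
  assumes "aleph0_saturated L M'" "ultra V"
    "\<forall>\<^sub>F i in V. range (x i) \<subseteq> univ M" "approximates L M M' {..<k} V x d"
  obtains d' where "approximates L M M' UNIV V x d'" "\<And>i. i < k \<Longrightarrow> d' i = d i"
proof -
  have "\<exists>D. \<forall>l. (approximates L M M' {..<k + l} V x (D l) \<and> (l = 0 \<longrightarrow> D l = d)) \<and>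
      (\<exists>a. D (Suc l) = (D l)(k + l := a))"
  proof (rule dependent_nat_choice)
    show "\<exists>d'. approximates L M M' {..<k + 0} V x d' \<and> (0 = (0::nat) \<longrightarrow> d' = d)"
      using assms by auto
    fix d' and l :: nat
    assume "approximates L M M' {..<k + l} V x d' \<and> (l = 0 \<longrightarrow> d' = d)"
    then have "approximates L M M' {..<k + l} V x d'"
      by blast
    from realise_step[OF assms(1-3) this] obtain a
      where "approximates L M M' {..<Suc (k + l)} V x (d'(k + l := a))"
      by blast
    then show "\<exists>d''. (approximates L M M' {..<k + Suc l} V x d'' \<and> (Suc l = 0 \<longrightarrow> d'' = d)) \<and>
        (\<exists>a. d'' = d'(k + l := a))"
      by auto
  qed
  then obtain D where D: "\<And>l. approximates L M M' {..<k + l} V x (D l)" "D 0 = d"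
      "\<And>l. \<exists>a. D (Suc l) = (D l)(k + l := a)"
    by blast
  have stable: "D (l + r) i = D l i" if "i < k + l" for l r i
  proof (induction r)
    case (Suc r)
    obtain a where "D (Suc (l + r)) = (D (l + r))(k + (l + r) := a)"
      using D(3) by blast
    then show ?case
      using Suc that by simp
  qed simp
  \<comment> \<open>Entry \<open>i\<close> is settled by stage \<open>Suc i\<close>, as
    \<open>i < k + Suc i\<close>.\<close>
  define d' where "d' i = D (Suc i) i" for i
  have d'_eq: "d' i = D l i" if "i < k + l" for i l
  proof (cases "l \<le> Suc i")
    case True
    then show ?thesis
      using stable[of i l "Suc i - l"] that by (simp add: d'_def)
  next
    case False
    then show ?thesis
      using stable[of i "Suc i" "l - Suc i"] by (simp add: d'_def)
  qed
  show thesis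
  proof (rule that[of d'], unfold approximates_def, intro conjI allI impI)
    show "range d' \<subseteq> univ M'"
      using D(1) by (auto simp: approximates_def d'_def)
    fix \<chi> assume \<chi>: "wf_fm L \<chi> \<and> fv \<chi> \<subseteq> UNIV \<and> sat M' d' \<chi>"
    have fv: "fv \<chi> \<subseteq> {..<k + var_bound \<chi>}"
      using fv_var_bound[of \<chi>] by auto
    have "sat M' (D (var_bound \<chi>)) \<chi> = sat M' d' \<chi>"
      by (rule sat_agree[OF fv]) (simp add: d'_eq)
    then show "\<forall>\<^sub>F i in V. sat M (x i) \<chi>"
      using approximatesD[OF D(1) _ fv] \<chi> by simp
  qed (use d'_eq[of _ 0] D(2) in simp)
qed

subsection \<open>Linked parameters\<close>

text \<open>
  The parameter sequences \<open>b\<close> of \<open>M'\<close> and \<open>d\<close> of \<open>N'\<close> are linked by a filter on the pairs of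
  parameter sequences of \<open>M\<close> and \<open>N\<close> that converges to the pair of their types.
  This replaces an elementary extension of the pair \<open>(N, M)\<close> containing both \<open>M'\<close> and \<open>N'\<close>.
\<close>

definition linked :: "('f, 'r) lang \<Rightarrow> ('f, 'r, 'a) struct \<Rightarrow> ('f, 'r, 'c) struct \<Rightarrow>
    ('g, 's) lang \<Rightarrow> ('g, 's, 'b) struct \<Rightarrow> ('g, 's, 'd) struct \<Rightarrow>
    ((nat \<Rightarrow> 'a) \<times> (nat \<Rightarrow> 'b)) filter \<Rightarrow> (nat \<Rightarrow> 'c) \<Rightarrow> (nat \<Rightarrow> 'd) \<Rightarrow> bool" where
  "linked L M M' K N N' U b d \<longleftrightarrow> U \<noteq> bot \<and>
     (\<forall>\<^sub>F (e, f) in U. range e \<subseteq> univ M \<and> range f \<subseteq> univ N) \<and>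
     approximates L M M' UNIV U fst b \<and> approximates K N N' UNIV U snd d"

text \<open>Pairs \<open>(e', f)\<close> are asked to satisfy the formulas true of \<open>b'\<close>
  and to have \<open>e'\<close> agree below \<open>k\<close> with some \<open>e\<close> for which
  \<open>(e, f)\<close> is typical for \<open>U\<close>. An ultrafilter meeting these demands
  determines the type of \<open>d'\<close> once the entries of \<open>f\<close> from
  \<open>k\<close> on are replaced by \<open>h e'\<close>.\<close>

lemma linked_extend:
  fixes M :: "('f, 'r, 'a) struct" and N :: "('g, 's, 'b) struct"
  assumes link: "linked L M M' K N N' U b d"
    and sat: "aleph0_saturated K N'"
    and b': "range b' \<subseteq> univ M'" "\<And>i. i < k \<Longrightarrow> b' i = b i"
    and h: "\<And>e. range e \<subseteq> univ M \<Longrightarrow> range (h e) \<subseteq> univ N"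
  obtains U' d' where "linked L M M' K N N' U' b' d'" "\<forall>i<k. d' i = d i"
    "\<forall>P. eventually P U \<longrightarrow> (\<forall>\<^sub>F (e', f') in U'. range e' \<subseteq> univ M \<and>
       (\<exists>e f. P (e, f) \<and> (\<forall>i<k. e' i = e i \<and> f' i = f i) \<and> (\<forall>i. f' (k + i) = h e' i)))"
proof -
  define R where "R = (\<lambda>(e :: nat \<Rightarrow> 'a, f :: nat \<Rightarrow> 'b). range e \<subseteq> univ M \<and> range f \<subseteq> univ N)"
  have R: "eventually R U"
    using link by (simp add: linked_def R_def)
  have appM: "approximates L M M' UNIV U fst b" and appN: "approximates K N N' UNIV U snd d"
    and "U \<noteq> bot"
    using link by (auto simp: linked_def)
  define S where "S = (\<lambda>(\<theta>, P). {(e', f). sat M e' \<theta> \<and> range e' \<subseteq> univ M \<and>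
      (\<exists>e. P (e, f) \<and> R (e, f) \<and> (\<forall>i<k. e' i = e i))})"
  define \<Theta> where "\<Theta> = {\<theta>. wf_fm L \<theta> \<and> sat M' b' \<theta>} \<times> {P. eventually P U}"
  define W where "W = (INF j \<in> \<Theta>. principal (S j))"
  have "\<Theta> \<noteq> {}"
  proof -
    have "(Conjs [], \<lambda>_. True) \<in> \<Theta>"
      by (simp add: \<Theta>_def)
    then show ?thesis
      by blast
  qed
  have W: "eventually P W \<longleftrightarrow> (\<exists>j \<in> \<Theta>. eventually P (principal (S j)))" for P
    unfolding W_def
  proof (rule eventually_INF_base[OF \<open>\<Theta> \<noteq> {}\<close>])
    fix i j assume "i \<in> \<Theta>" "j \<in> \<Theta>"
    then obtain \<theta> P \<theta>' P' where ij: "i = (\<theta>, P)" "j = (\<theta>', P')"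
        "wf_fm L \<theta>" "sat M' b' \<theta>" "eventually P U" "wf_fm L \<theta>'" "sat M' b' \<theta>'" "eventually P' U"
      by (auto simp: \<Theta>_def)
    show "\<exists>l \<in> \<Theta>. principal (S l) \<le> inf (principal (S i)) (principal (S j))"
    proof (rule bexI)
      show "(Conj \<theta> \<theta>', \<lambda>x. P x \<and> P' x) \<in> \<Theta>"
        using ij by (simp add: \<Theta>_def eventually_conj)
    qed (auto simp: S_def ij)
  qed
  have "S j \<noteq> {}" if j: "j \<in> \<Theta>" for j
  proof -
    obtain \<theta> P where \<theta>P: "j = (\<theta>, P)" "wf_fm L \<theta>" "sat M' b' \<theta>" "eventually P U"
      using j by (auto simp: \<Theta>_def)
    \<comment> \<open>Quantifying away the variables from \<open>k\<close> on leaves a formula on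
      which \<open>b'\<close> and \<open>b\<close> agree. It therefore holds for
      \<open>U\<close>-most \<open>e\<close>, and its witnesses give the new tail of
      \<open>e'\<close>.\<close>
    let ?vs = "[k..<var_bound \<theta>]"
    have fv: "fv (foldr Ex ?vs \<theta>) \<subseteq> {..<k}"
      using fv_var_bound[of \<theta>] by (auto simp: fv_foldr_Ex)
    have "sat M' b' (foldr Ex ?vs \<theta>)"
      unfolding sat_foldr_Ex using b'(1) \<theta>P by (intro exI[of _ b']) auto
    then have "sat M' b (foldr Ex ?vs \<theta>)"
      using sat_agree[OF fv] b'(2) by blast
    then have "\<forall>\<^sub>F i in U. sat M (fst i) (foldr Ex ?vs \<theta>)"
      using \<theta>P by (intro approximatesD[OF appM]) auto
    with R \<theta>P(4) have "\<forall>\<^sub>F i in U. R i \<and> P i \<and> sat M (fst i) (foldr Ex ?vs \<theta>)"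
      by eventually_elim simp
    then obtain e f where ef: "R (e, f)" "P (e, f)" "sat M e (foldr Ex ?vs \<theta>)"
      using \<open>U \<noteq> bot\<close> eventually_happens by fastforce
    then obtain e' where e': "\<forall>i. i \<notin> set ?vs \<longrightarrow> e' i = e i" "\<forall>i \<in> set ?vs. e' i \<in> univ M" "sat M e' \<theta>"
      unfolding sat_foldr_Ex by blast
    have "e' i \<in> univ M" for i
      using e' ef by (cases "i \<in> set ?vs") (auto simp: R_def)
    moreover have "\<forall>i<k. e' i = e i"
      using e' by auto
    ultimately have "(e', f) \<in> S j"
      using ef e'(3) unfolding S_def \<theta>P by blast
    then show ?thesis
      by blast
  qed
  then have "W \<noteq> bot"
    unfolding trivial_limit_def W eventually_principal by blast
  then obtain V where V: "V \<le> W" "ultra V"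
    using ultrafilter_below by blast
  have ev: "\<forall>\<^sub>F i in V. i \<in> S j" if "j \<in> \<Theta>" for j
    by (rule filter_leD[OF V(1)]) (use that in \<open>auto simp: W eventually_principal\<close>)
  have ev\<theta>: "\<forall>\<^sub>F i in V. i \<in> S (\<theta>, R)" if "wf_fm L \<theta>" "sat M' b' \<theta>" for \<theta>
    by (rule ev) (use that R in \<open>simp add: \<Theta>_def\<close>)
  have evP: "\<forall>\<^sub>F i in V. i \<in> S (Conjs [], P)" if "eventually P U" for P
    by (rule ev) (use that in \<open>simp add: \<Theta>_def\<close>)
  define x where "x = (\<lambda>(e', f). assign (map f [0..<k]) (h e') :: nat \<Rightarrow> 'b)"
  have x_eq: "x (e', f) i = f i" if "i < k" for e' f i
    using that by (simp add: x_def assign_def)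
  have x_range: "range (x i) \<subseteq> univ N" if "i \<in> S (Conjs [], R)" for i
  proof -
    obtain e' f where i: "i = (e', f)"
      by fastforce
    have "range f \<subseteq> univ N" "range e' \<subseteq> univ M"
      using that by (auto simp: S_def R_def i)
    then show ?thesis
      unfolding x_def i prod.case by (intro range_assign h) auto
  qed
  have "\<forall>\<^sub>F i in V. range (x i) \<subseteq> univ N"
    using evP[OF R] by eventually_elim (rule x_range)
  moreover have "approximates K N N' {..<k} V x d"
    unfolding approximates_def
  proof (intro conjI allI impI)
    show "range d \<subseteq> univ N'"
      using appN by (simp add: approximates_def)
    fix \<chi> assume \<chi>: "wf_fm K \<chi> \<and> fv \<chi> \<subseteq> {..<k} \<and> sat N' d \<chi>"
    then have "\<forall>\<^sub>F i in U. sat N (snd i) \<chi>"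
      by (intro approximatesD[OF appN]) auto
    from evP[OF this] show "\<forall>\<^sub>F i in V. sat N (x i) \<chi>"
    proof eventually_elim
      case (elim i)
      then obtain e' f where i: "i = (e', f)" "sat N f \<chi>"
        by (auto simp: S_def)
      have "sat N (x i) \<chi> = sat N f \<chi>"
        by (rule sat_agree[of _ k]) (use \<chi> in \<open>auto simp: i x_eq\<close>)
      with i show ?case
        by simp
    qed
  qed
  ultimately obtain d' where d': "approximates K N N' UNIV V x d'" "\<And>i. i < k \<Longrightarrow> d' i = d i"
    using realise[OF sat V(2)] by blast
  \<comment> \<open>The ultrafilter lives on pairs \<open>(e', f)\<close>; its image replaces
    \<open>f\<close> by the sequence \<open>x\<close> with the prescribed tail.\<close>
  define U' where "U' = filtermap (\<lambda>i. (fst i, x i)) V"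
  show thesis
  proof (rule that[of U' d'])
    show "linked L M M' K N N' U' b' d'"
      unfolding linked_def
    proof (intro conjI)
      show "U' \<noteq> bot"
        using V(2) by (simp add: U'_def ultra_def filtermap_bot_iff)
      have "\<forall>\<^sub>F i in V. range (fst i) \<subseteq> univ M \<and> range (x i) \<subseteq> univ N"
        using evP[OF R]
      proof eventually_elim
        case (elim i)
        then show ?case
          using x_range[OF elim] by (auto simp: S_def)
      qed
      then show "\<forall>\<^sub>F (e, f) in U'. range e \<subseteq> univ M \<and> range f \<subseteq> univ N"
        by (simp add: U'_def eventually_filtermap)
      show "approximates K N N' UNIV U' snd d'"
        using d'(1) by (simp add: approximates_def U'_def eventually_filtermap)
      have "\<forall>\<^sub>F i in V. sat M (fst i) \<theta>" if "wf_fm L \<theta>" "sat M' b' \<theta>" for \<theta>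
        using ev\<theta>[OF that] by eventually_elim (auto simp: S_def)
      then show "approximates L M M' UNIV U' fst b'"
        using b'(1) by (simp add: approximates_def U'_def eventually_filtermap)
    qed
    have "\<forall>\<^sub>F i in V. range (fst i) \<subseteq> univ M \<and>
       (\<exists>e f. P (e, f) \<and> (\<forall>j<k. fst i j = e j \<and> x i j = f j) \<and> (\<forall>j. x i (k + j) = h (fst i) j))"
      if "eventually P U" for P
      using evP[OF that]
    proof eventually_elim
      case (elim i)
      obtain e' f where i: "i = (e', f)"
        by fastforce
      obtain e where e: "P (e, f)" "\<forall>j<k. e' j = e j" "range e' \<subseteq> univ M"
        using elim by (auto simp: S_def i)
      have "\<forall>j<k. x i j = f j" "\<forall>j. x i (k + j) = h e' j"
        by (simp_all add: x_def assign_def i)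
      with e show ?case
        unfolding i fst_conv by blast
    qed
    then show "\<forall>P. eventually P U \<longrightarrow> (\<forall>\<^sub>F (e', f') in U'. range e' \<subseteq> univ M \<and>
       (\<exists>e f. P (e, f) \<and> (\<forall>i<k. e' i = e i \<and> f' i = f i) \<and> (\<forall>i. f' (k + i) = h e' i)))"
      by (simp add: U'_def eventually_filtermap)
  qed (simp add: d'(2))
qed

subsection \<open>Transfer of the rank\<close>

lemma concat_tuples:
  assumes "A \<subseteq> tuples B n" "as \<in> tuples A m"
  shows "concat as \<in> tuples B (m * n)"
  using assms(2)
proof (induction as arbitrary: m)
  case (Cons a as)
  then obtain l where l: "m = Suc l" "as \<in> tuples A l" "a \<in> A"
    by (auto simp: tuples_def)
  have "a \<in> tuples B n" "concat as \<in> tuples B (l * n)"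
    using l assms(1) Cons.IH by auto
  then show ?case
    by (simp add: tuples_def l)
qed (auto simp: tuples_def)

text \<open>The trace definition is applied once, with the relevant parameters of \<phi> treated as
  further coordinates. Hence one \<psi> serves every \<open>e\<close>, and only its parameters
  \<open>g e\<close> vary.\<close>

lemma trace_formula:
  assumes trace: "trace_definition L M K N n (\<lambda>a. a)" and MN: "univ M \<subseteq> tuples (univ N) n"
    and str: "is_structure L M" and wf: "wf_fm L \<phi>"
  obtains \<psi> g where "wf_fm K \<psi>" "\<And>e. range e \<subseteq> univ M \<Longrightarrow> range (g e) \<subseteq> univ N"
    "\<And>e as. range e \<subseteq> univ M \<Longrightarrow> as \<in> tuples (univ M) m \<Longrightarrow>
       sat M (assign as e) \<phi> \<longleftrightarrow> sat N (assign (concat as) (g e)) \<psi>"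
proof -
  \<comment> \<open>The successor ensures \<open>m + k \<ge> 1\<close>, as the trace definition
    requires, even for \<open>m = 0\<close>.\<close>
  define k where "k = Suc (var_bound \<phi>)"
  have fv: "fv \<phi> \<subseteq> {..<m + k}"
    using fv_var_bound[of \<phi>] by (auto simp: k_def)
  obtain a where a: "a \<in> univ M"
    using str by (auto simp: is_structure_def)
  have "definable L M (m + k) (defset M (m + k) \<phi> (\<lambda>_. a))"
    unfolding definable_def by (rule bexI[of _ "(\<phi>, \<lambda>_. a)"]) (use a wf in \<open>auto simp: formulas_over_def\<close>)
  moreover have "m + k \<ge> 1"
    by (simp add: k_def)
  ultimately have "\<exists>Y. definable K N ((m + k) * n) Y \<and>
      defset M (m + k) \<phi> (\<lambda>_. a) = {as \<in> tuples (univ M) (m + k). concat (map (\<lambda>a. a) as) \<in> Y}"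
    using trace unfolding trace_definition_def by blast
  then obtain Y where Y: "definable K N ((m + k) * n) Y"
      "defset M (m + k) \<phi> (\<lambda>_. a) = {as \<in> tuples (univ M) (m + k). concat as \<in> Y}"
    by auto
  then obtain \<psi> c where \<psi>: "wf_fm K \<psi>" "range c \<subseteq> univ N" "Y = defset N ((m + k) * n) \<psi> c"
    by (auto simp: definable_def formulas_over_def)
  note concat = concat_tuples[OF MN]
  show thesis
  \<comment> \<open>The coordinates that came from \<open>e\<close> turn back into parameters,
    followed by the parameters \<open>c\<close> of \<psi>.\<close>
  proof (rule that[of \<psi> "\<lambda>e. assign (concat (map e [0..<k])) c"])
    fix e :: "nat \<Rightarrow> _" assume e: "range e \<subseteq> univ M"
    then have es: "map e [0..<k] \<in> tuples (univ M) k"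
      by (auto simp: tuples_def)
    show "range (assign (concat (map e [0..<k])) c) \<subseteq> univ N"
      using concat[OF es] \<psi>(2) by (intro range_assign) (auto simp: tuples_def)
    fix as assume as: "as \<in> tuples (univ M) m"
    have ases: "as @ map e [0..<k] \<in> tuples (univ M) (m + k)"
      using as es by (auto simp: tuples_def)
    have "sat M (assign as e) \<phi> \<longleftrightarrow> sat M (assign (as @ map e [0..<k]) (\<lambda>_. a)) \<phi>"
      by (rule sat_agree[OF fv]) (use as in \<open>auto simp: tuples_def assign_def nth_append\<close>)
    also have "\<dots> \<longleftrightarrow> as @ map e [0..<k] \<in> defset M (m + k) \<phi> (\<lambda>_. a)"
      using ases by (simp add: defset_def)
    also have "\<dots> \<longleftrightarrow> sat N (assign (concat (as @ map e [0..<k])) c) \<psi>"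
      unfolding Y(2) \<psi>(3) using ases concat[OF ases] by (simp add: defset_def)
    finally show "sat M (assign as e) \<phi> \<longleftrightarrow> sat N (assign (concat as) (assign (concat (map e [0..<k])) c)) \<psi>"
      by (simp add: assign_append)
  qed (rule \<psi>(1))
qed

section \<open>Definable sets under a change of parameter sequence\<close>

lemma defset_agree:
  assumes "fv \<phi> \<subseteq> {..<k}" "\<And>i. i < k \<Longrightarrow> b i = b' i"
  shows "defset M m \<phi> b = defset M m \<phi> b'"
proof -
  have "sat M (assign as b) \<phi> = sat M (assign as b') \<phi>" for as
  proof (rule sat_agree[OF assms(1)])
    fix i assume "i < k"
    then show "assign as b i = assign as b' i"
      using assms(2)[of "i - length as"] by (simp add: assign_def)
  qed
  then show ?thesis
    unfolding defset_def by blast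
qed

lemma defset_ren_shift:
  assumes "inj \<rho>"
  shows "defset M m (ren (shift m \<rho>) \<phi>) b = defset M m \<phi> (b \<circ> \<rho>)"
  unfolding defset_def
  by (intro Collect_cong conj_cong refl sat_ren_shift[OF assms]) (simp add: tuples_def)

text \<open>Inclusion is only required between \<open>M\<close> and \<open>N\<close>, for most
  parameters along \<open>U\<close>, since \<open>M'\<close> and \<open>N'\<close> have no common
  ambient structure. Formulas, parameters and filter all vary in the induction, because each
  successor step enlarges the parameter sequences.\<close>

lemma rank_transfer:
  fixes M :: "('f, 'r, 'b list) struct" and N :: "('g, 's, 'b) struct"
    and M' :: "('f, 'r, 'c) struct" and N' :: "('g, 's, 'd) struct"
  assumes trace: "trace_definition L M K N n (\<lambda>a. a)" and MN: "univ M \<subseteq> tuples (univ N) n"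
    and strM: "is_structure L M" and sat: "aleph0_saturated K N'"
  shows "rank_ge L M' m A \<alpha> \<Longrightarrow> A = defset M' m \<phi> b \<Longrightarrow> wf_fm L \<phi> \<Longrightarrow> wf_fm K \<psi> \<Longrightarrow>
    linked L M M' K N N' U b d \<Longrightarrow>
    \<forall>\<^sub>F (e, f) in U. \<forall>as \<in> tuples (univ M) m. sat M (assign as e) \<phi> \<longrightarrow> sat N (assign (concat as) f) \<psi> \<Longrightarrow>
    rank_ge K N' (m * n) (defset N' (m * n) \<psi> d) \<alpha>"
proof (induction A \<alpha> arbitrary: \<phi> b \<psi> U d rule: rank_ge.induct)
  case (zero \<alpha> A)
  have appM: "approximates L M M' UNIV U fst b" and appN: "approximates K N N' UNIV U snd d"
    and "U \<noteq> bot"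
    using zero.prems by (auto simp: linked_def)
  \<comment> \<open>Nonemptiness passes from \<open>M'\<close> to \<open>M\<close> along
    \<open>U\<close>, to \<open>N\<close> by concatenating a point, and on to
    \<open>N'\<close>.\<close>
  have "sat M' b (ex_coords m \<phi>)"
    using zero by (auto simp: sat_ex_coords defset_def)
  then have "\<forall>\<^sub>F i in U. sat M (fst i) (ex_coords m \<phi>)"
    using zero.prems by (intro approximatesD[OF appM]) auto
  with zero.prems(5) have "\<forall>\<^sub>F i in U. sat N (snd i) (ex_coords (m * n) \<psi>)"
  proof eventually_elim
    case (elim i)
    then show ?case
      by (auto simp: sat_ex_coords intro!: bexI[OF _ concat_tuples[OF MN]])
  qed
  then have "sat N' d (ex_coords (m * n) \<psi>)"
    using zero.prems \<open>U \<noteq> bot\<close> by (intro approximatesD_converse[OF appN]) auto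
  then have "defset N' (m * n) \<psi> d \<noteq> {}"
    by (auto simp: sat_ex_coords defset_def)
  with zero.hyps show ?case
    by (intro rank_ge.zero)
next
  case (limit \<alpha> A)
  show ?case
  proof (rule rank_ge.limit[OF limit.hyps(1)])
    fix \<beta> assume "\<beta> < \<alpha>"
    then show "rank_ge K N' (m * n) (defset N' (m * n) \<psi> d) \<beta>"
      using limit.prems by (rule limit.IH)
  qed
next
  case (succ \<beta> \<alpha> B A)
  obtain ph bb where B: "\<And>i. wf_fm L (ph i)" "\<And>i. range (bb i) \<subseteq> univ M'"
      "\<And>i. B i = defset M' m (ph i) (bb i)"
  proof -
    have "\<exists>\<phi> e. wf_fm L \<phi> \<and> range e \<subseteq> univ M' \<and> B i = defset M' m \<phi> e" for i
      using succ.hyps(2)[of i] by (force simp: definable_def formulas_over_def)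
    then show thesis
      using that by metis
  qed
  obtain ps g where tr: "\<And>i. wf_fm K (ps i)" "\<And>i e. range e \<subseteq> univ M \<Longrightarrow> range (g i e) \<subseteq> univ N"
      "\<And>i e as. range e \<subseteq> univ M \<Longrightarrow> as \<in> tuples (univ M) m \<Longrightarrow>
         sat M (assign as e) (ph i) \<longleftrightarrow> sat N (assign (concat as) (g i e)) (ps i)"
  proof -
    have "\<exists>\<psi> g. wf_fm K \<psi> \<and> (\<forall>e. range e \<subseteq> univ M \<longrightarrow> range (g e) \<subseteq> univ N) \<and>
        (\<forall>e as. range e \<subseteq> univ M \<longrightarrow> as \<in> tuples (univ M) m \<longrightarrow>
         sat M (assign as e) (ph i) = sat N (assign (concat as) (g e)) \<psi>)" for i
      by (rule trace_formula[OF trace MN strM B(1)[of i], of m]) blast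
    then show thesis
      using that by metis
  qed
  define k where "k = max (var_bound \<phi>) (var_bound \<psi>)"
  have fv: "fv \<phi> \<subseteq> {..<k}" "fv \<psi> \<subseteq> {..<k}"
    using fv_var_bound[of \<phi>] fv_var_bound[of \<psi>] by (auto simp: k_def)
  \<comment> \<open>Position \<open>k + prod_encode (i, l)\<close> stores parameter \<open>l\<close>
    of the \<open>i\<close>-th formula, so one sequence carries the old parameters and those of all
    the \<open>B i\<close>.\<close>
  define \<rho> where "\<rho> i l = k + prod_encode (i, l)" for i l
  have inj: "inj (\<rho> i)" for i
    by (rule injI) (simp add: \<rho>_def)
  define b' where "b' = assign (map b [0..<k]) (\<lambda>x. case prod_decode x of (i, l) \<Rightarrow> bb i l)"
  \<comment> \<open>The same layout on the side of \<open>N\<close>: block \<open>i\<close> is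
    computed from block \<open>i\<close> of \<open>e\<close> by \<open>g i\<close>.\<close>
  define h where "h e x = (case prod_decode x of (i, l) \<Rightarrow> g i (e \<circ> \<rho> i) l)" for e :: "nat \<Rightarrow> 'b list" and x
  have b'_range: "range b' \<subseteq> univ M'"
    unfolding b'_def
  proof (rule range_assign)
    show "set (map b [0..<k]) \<subseteq> univ M'"
      using succ.prems(4) by (auto simp: linked_def approximates_def)
    show "range (\<lambda>x. case prod_decode x of (i, l) \<Rightarrow> bb i l) \<subseteq> univ M'"
      using B(2) by (auto simp: image_subset_iff split: prod.split)
  qed
  have b'_eq: "b' i = b i" if "i < k" for i
    using that by (simp add: b'_def assign_def)
  have h_range: "range (h e) \<subseteq> univ N" if e: "range e \<subseteq> univ M" for e
  proof -
    have "range (g i (e \<circ> \<rho> i)) \<subseteq> univ N" for i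
      by (rule tr(2)) (use e in auto)
    then show ?thesis
      by (auto simp: h_def image_subset_iff split: prod.split)
  qed
  obtain U' d' where link': "linked L M M' K N N' U' b' d'" and d'_eq: "\<forall>i<k. d' i = d i"
    and U': "\<forall>P. eventually P U \<longrightarrow> (\<forall>\<^sub>F (e', f') in U'. range e' \<subseteq> univ M \<and>
       (\<exists>e f. P (e, f) \<and> (\<forall>i<k. e' i = e i \<and> f' i = f i) \<and> (\<forall>i. f' (k + i) = h e' i)))"
    by (rule linked_extend[OF succ.prems(4) sat b'_range, of k h], erule b'_eq, erule h_range)
  have appM: "approximates L M M' UNIV U' fst b'" and d'_range: "range d' \<subseteq> univ N'"
    using link' by (auto simp: linked_def approximates_def)
  define ph' where "ph' i = ren (shift m (\<rho> i)) (ph i)" for i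
  define ps' where "ps' i = ren (shift (m * n) (\<rho> i)) (ps i)" for i
  \<comment> \<open>Away from tuples of \<open>M\<close> the sets of the \<open>ps' i\<close> may
    overlap or leave that of \<psi>. The cuts repair this and lose no trace points, as the
    \<open>B i\<close> are disjoint and contained in \<open>A\<close>.\<close>
  define C where "C i = Conjs (\<psi> # ps' i # map (\<lambda>j. Neg (ps' j)) [0..<i])" for i
  have wf: "wf_fm L (ph' i)" "wf_fm K (ps' i)" "wf_fm K (C i)" for i
    using B(1) tr(1) succ.prems by (auto simp: ph'_def ps'_def C_def)
  have "b' \<circ> \<rho> i = bb i" for i
    by (auto simp: fun_eq_iff b'_def \<rho>_def assign_def)
  then have B': "B i = defset M' m (ph' i) b'" for i
    by (simp add: ph'_def defset_ren_shift inj B(3))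
  have A': "A = defset M' m \<phi> b'"
    unfolding succ.prems(1) by (rule defset_agree[OF fv(1)]) (simp add: b'_eq)
  have trace': "sat M (assign as e) (ph' i) \<longleftrightarrow> sat N (assign (concat as) f) (ps' i)"
    if "range e \<subseteq> univ M" "\<forall>l. f (k + l) = h e l" "as \<in> tuples (univ M) m" for e f as i
  proof -
    have "f \<circ> \<rho> i = g i (e \<circ> \<rho> i)"
      using that by (auto simp: fun_eq_iff \<rho>_def h_def)
    moreover have "length as = m" "length (concat as) = m * n"
      using that(3) concat_tuples[OF MN that(3)] by (simp_all add: tuples_def)
    moreover have "range (e \<circ> \<rho> i) \<subseteq> univ M"
      using that by auto
    ultimately show ?thesis
      using tr(3)[of "e \<circ> \<rho> i" as i] that(3) by (simp add: ph'_def ps'_def sat_ren_shift inj)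
  qed
  \<comment> \<open>Inclusion and disjointness in \<open>M'\<close> are emptiness statements about
    parameters, so they hold in \<open>M\<close> for most parameters along
    \<open>U'\<close>.\<close>
  have empty: "\<forall>\<^sub>F i in U'. \<forall>as \<in> tuples (univ M) m. \<not> sat M (assign as (fst i)) \<theta>"
    if "wf_fm L \<theta>" "defset M' m \<theta> b' = {}" for \<theta>
  proof -
    have "\<forall>\<^sub>F i in U'. sat M (fst i) (Neg (ex_coords m \<theta>))"
      by (rule approximatesD[OF appM]) (use that in \<open>auto simp: sat_ex_coords defset_def\<close>)
    then show ?thesis
      by (simp add: sat_ex_coords)
  qed
  have incl: "\<forall>\<^sub>F (e, f) in U'. \<forall>as \<in> tuples (univ M) m.
      sat M (assign as e) (ph' i) \<longrightarrow> sat N (assign (concat as) f) (C i)" for i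
  proof -
    have "defset M' m (Conj (ph' i) (Neg \<phi>)) b' = {}"
      using succ.hyps(3)[of i] unfolding A' B' by (auto simp: defset_def)
    then have sub: "\<forall>\<^sub>F p in U'. \<forall>as \<in> tuples (univ M) m. \<not> sat M (assign as (fst p)) (Conj (ph' i) (Neg \<phi>))"
      using wf succ.prems by (intro empty) auto
    have "defset M' m (Conj (ph' i) (ph' j)) b' = {}" if "j < i" for j
      using succ.hyps(4)[of i j] that unfolding B' by (auto simp: defset_def)
    then have disj: "\<forall>\<^sub>F p in U'. \<forall>j \<in> {..<i}. \<forall>as \<in> tuples (univ M) m.
        \<not> sat M (assign as (fst p)) (Conj (ph' i) (ph' j))"
      using wf by (intro eventually_ball_finite ballI empty) auto
    from U'[rule_format, OF succ.prems(5)] sub disj show ?thesis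
    proof eventually_elim
      case (elim p)
      obtain e' f' where p: "p = (e', f')"
        by fastforce
      obtain e f where ef: "\<forall>as \<in> tuples (univ M) m. sat M (assign as e) \<phi> \<longrightarrow> sat N (assign (concat as) f) \<psi>"
          "\<forall>i<k. e' i = e i \<and> f' i = f i" "\<forall>i. f' (k + i) = h e' i" "range e' \<subseteq> univ M"
        using elim(1) unfolding p by auto
      have "sat N (assign (concat as) f') (C i)"
        if as: "as \<in> tuples (univ M) m" "sat M (assign as e') (ph' i)" for as
      proof -
        have "sat M (assign as e') \<phi>"
          using elim(2) as p by auto
        moreover have "sat M (assign as e') \<phi> = sat M (assign as e) \<phi>"
          by (rule sat_agree[OF fv(1)]) (use ef in \<open>auto simp: assign_def\<close>)
        moreover have "sat N (assign (concat as) f') \<psi> = sat N (assign (concat as) f) \<psi>"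
          by (rule sat_agree[OF fv(2)]) (use ef in \<open>auto simp: assign_def\<close>)
        ultimately have "sat N (assign (concat as) f') \<psi>"
          using ef as by blast
        moreover have "\<not> sat N (assign (concat as) f') (ps' j)" if "j < i" for j
          using elim(3) as that trace'[OF ef(4) ef(3) as(1), of j] by (auto simp: p)
        ultimately show ?thesis
          using as(2) trace'[OF ef(4) ef(3) as(1), of i] by (simp add: C_def)
      qed
      then show ?case
        by (simp add: p)
    qed
  qed
  show ?case
  proof (rule rank_ge.succ[OF succ.hyps(1)])
    fix i
    show "definable K N' (m * n) (defset N' (m * n) (C i) d')"
      unfolding definable_def
      by (rule bexI[of _ "(C i, d')"]) (use wf d'_range in \<open>auto simp: formulas_over_def\<close>)
    have "defset N' (m * n) \<psi> d = defset N' (m * n) \<psi> d'"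
      by (rule defset_agree[OF fv(2)]) (simp add: d'_eq)
    then show "defset N' (m * n) (C i) d' \<subseteq> defset N' (m * n) \<psi> d"
      by (auto simp: defset_def C_def)
    show "rank_ge K N' (m * n) (defset N' (m * n) (C i) d') \<beta>"
      by (rule succ.IH[OF B' wf(1,3) link' incl])
    fix j assume "i \<noteq> (j::nat)"
    then have "i < j \<or> j < i"
      by auto
    then show "defset N' (m * n) (C i) d' \<inter> defset N' (m * n) (C j) d' = {}"
      by (auto simp: defset_def C_def)
  qed
qed

theorem proposition3p10:
  fixes L :: "('f, 'r) lang" and M :: "('f, 'r, 'b list) struct"
    and K :: "('g, 's) lang" and N :: "('g, 's, 'b) struct"
    and M' :: "('f, 'r, 'c) struct" and N' :: "('g, 's, 'd) struct"
    and j\<^sub>M :: "'b list \<Rightarrow> 'c" and j\<^sub>N :: "'b \<Rightarrow> 'd"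
    and X :: "'b list list set" and Y :: "'b list set"
    and n m :: nat
  assumes "is_structure L M" and "is_structure K N"
    and "univ M \<subseteq> tuples (univ N) n"
    and "trace_definition L M K N n (\<lambda>a. a)"
    and "definable L M m X"
    and "definable K N (m * n) Y"
    and "X = {as \<in> tuples (univ M) m. concat as \<in> Y}"
    and "saturated_extension L M j\<^sub>M M'"
    and "saturated_extension K N j\<^sub>N N'"
  shows "\<forall>\<alpha> :: 'o::wellorder.
           morley_rank_ge L M j\<^sub>M M' m X \<alpha> \<longrightarrow> morley_rank_ge K N j\<^sub>N N' (m * n) Y \<alpha>"
proof (intro allI impI)
  fix \<alpha> :: 'o
  assume "morley_rank_ge L M j\<^sub>M M' m X \<alpha>"
  then obtain \<phi> p where \<phi>: "wf_fm L \<phi>" "range p \<subseteq> univ M" "X = defset M m \<phi> p"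
      "rank_ge L M' m (defset M' m \<phi> (j\<^sub>M \<circ> p)) \<alpha>"
    by (auto simp: morley_rank_ge_def formulas_over_def)
  obtain \<psi> q where \<psi>: "wf_fm K \<psi>" "range q \<subseteq> univ N" "Y = defset N (m * n) \<psi> q"
    using assms(6) by (auto simp: definable_def formulas_over_def)
  \<comment> \<open>The parameters start in \<open>M\<close> and \<open>N\<close> themselves, so the
    single pair \<open>(p, q)\<close> already has the types of its images.\<close>
  let ?U = "principal {(p, q)}"
  have "linked L M M' K N N' ?U (j\<^sub>M \<circ> p) (j\<^sub>N \<circ> q)"
    unfolding linked_def
    using assms(8,9) \<phi>(2) \<psi>(2)
    by (auto simp: saturated_extension_def eventually_principal principal_eq_bot_iff intro!: approximates_elementary)
  moreover have "\<forall>\<^sub>F (e, f) in ?U. \<forall>as \<in> tuples (univ M) m.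
      sat M (assign as e) \<phi> \<longrightarrow> sat N (assign (concat as) f) \<psi>"
    using assms(7) unfolding \<phi>(3) \<psi>(3) by (auto simp: eventually_principal defset_def)
  ultimately have "rank_ge K N' (m * n) (defset N' (m * n) \<psi> (j\<^sub>N \<circ> q)) \<alpha>"
    using assms \<phi> \<psi> by (intro rank_transfer[OF assms(4,3,1) _ \<phi>(4) refl]) (auto simp: saturated_extension_def)
  with \<psi> show "morley_rank_ge K N j\<^sub>N N' (m * n) Y \<alpha>"
    by (auto simp: morley_rank_ge_def formulas_over_def)
qed

end
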